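(* Let $\sigma=\{R_1,\dots,R_n\}$ be a finite signature with arities $k_1,\dots,k_n$ such that $k_1\ge 2$. For every $\star$-graph $\mathbf H$ there exists a $(\star,\sigma)$-structure $\mathbf A$ such that the problems $\mathrm{MP}_\star(\mathbf H)$ and $\mathrm{MP}^\sigma_\star(\mathbf A)$ are polynomial-time equivalent.
   Context: Given a poset $(P,\preceq)$ and a signature $\sigma$, a $(P,\sigma)$-structure $\mathbf G$ consists of a finite domain $G$ and, for each $R\in\sigma$ of arity $k$, a map $R^{\mathbf G}\colon G^k\to P$. A homomorphism $h\colon\mathbf G\to\mathbf H$ is a map $h\colon G\to H$ with $R^{\mathbf G}(\mathbf t)\preceq R^{\mathbf H}(h(\mathbf t))$ for all $R\in\sigma$ and all tuples $\mathbf t$. Let $P_\star=\{0,1,\star\}$ with $0\preceq\star$, $1\preceq\star$, $0,1$ incomparable; $(P_\star,\sigma)$-structures are called $(\star,\sigma)$-structures, and for $\sigma=\{E\}$ with $E$ binary they are called $\star$-graphs. For a $(\star,\sigma)$-structure $\mathbf A$, $\mathrm{MP}^\sigma_\star(\mathbf A)$ is the decision problem: given a $(\star,\sigma)$-structure $\mathbf G$, is there a homomorphism $\mathbf G\to\mathbf A$?; for $\sigma=\{E\}$ it is written $\mathrm{MP}_\star$. Standing assumption: targets have no element $x$ with $R(x,\dots,x)=\star$ for all relation symbols $R$. Two decision problems are polynomial-time equivalent if each polynomial-time reduces to the other. *)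

theory Defs
  imports "HOL-Library.FuncSet" "HOL-Computational_Algebra.Polynomial"
begin

section \<open>Structures over a poset\<close>

text \<open>A finite signature is the list of arities of its relation symbols. The poset \<open>P\<close> is
  the whole type \<open>'p\<close>. Values of \<open>rel G i\<close> on lists that are not tuples over \<open>univ G\<close> of the
  right arity are irrelevant; no definition below looks at them.\<close>

type_synonym signature = "nat list"

record ('p, 'a) pstructure =
  univ :: "'a set"
  rel :: "nat \<Rightarrow> 'a list \<Rightarrow> 'p"

definition finite_structure :: "('p, 'a) pstructure \<Rightarrow> bool" where
  "finite_structure G \<longleftrightarrow> finite (univ G)"

definition tuples :: "nat \<Rightarrow> 'a set \<Rightarrow> 'a list set" where
  "tuples k D = {t. length t = k \<and> set t \<subseteq> D}"

definition is_hom ::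
  "signature \<Rightarrow> ('p::order, 'a) pstructure \<Rightarrow> ('p, 'b) pstructure \<Rightarrow> ('a \<Rightarrow> 'b) \<Rightarrow> bool" where
  "is_hom \<sigma> G H h \<longleftrightarrow> h \<in> univ G \<rightarrow> univ H \<and>
     (\<forall>i < length \<sigma>. \<forall>t \<in> tuples (\<sigma> ! i) (univ G). rel G i t \<le> rel H i (map h t))"

datatype pstar = Zero | One | Star

instantiation pstar :: order
begin

definition less_eq_pstar :: "pstar \<Rightarrow> pstar \<Rightarrow> bool" where
  "x \<le> y \<longleftrightarrow> x = y \<or> y = Star"

definition less_pstar :: "pstar \<Rightarrow> pstar \<Rightarrow> bool" where
  "x < y \<longleftrightarrow> x \<noteq> y \<and> y = Star" for x y :: pstar

instance
  by standard (auto simp: less_eq_pstar_def less_pstar_def)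

end

abbreviation graph_sig :: signature where
  "graph_sig \<equiv> [2]"

definition no_star_loop :: "signature \<Rightarrow> (pstar, 'a) pstructure \<Rightarrow> bool" where
  "no_star_loop \<sigma> A \<longleftrightarrow>
     \<not> (\<exists>x \<in> univ A. \<forall>i < length \<sigma>. rel A i (replicate (\<sigma> ! i) x) = Star)"

section \<open>Deterministic multi-tape Turing machines\<close>

text \<open>Tapes are two-way infinite; symbol 0 is the blank. The states are \<open>0, \<dots>, n_states M\<close>, with
  initial state 0 and halting state \<open>n_states M\<close>. The input is on tape 0, the output on the
  last tape; both start at cell 0. Well-formedness makes the relevant part of \<open>delta\<close> a finite
  table.\<close>

type_synonym word = "nat list"

datatype move = Move_Left | Stay | Move_Right

record tm =
  n_tapes :: nat
  n_symbols :: nat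
  n_states :: nat
  delta :: "nat \<Rightarrow> nat list \<Rightarrow> nat \<times> (nat \<times> move) list"

definition wf_tm :: "tm \<Rightarrow> bool" where
  "wf_tm M \<longleftrightarrow> n_tapes M \<ge> 1 \<and> n_symbols M \<ge> 1 \<and>
     (\<forall>q < n_states M. \<forall>xs \<in> tuples (n_tapes M) {..<n_symbols M}.
        case delta M q xs of (q', acts) \<Rightarrow>
          q' \<le> n_states M \<and> length acts = n_tapes M \<and> (\<forall>(s, m) \<in> set acts. s < n_symbols M))"

type_synonym tape = "(int \<Rightarrow> nat) \<times> int"
type_synonym config = "nat \<times> tape list"

definition word_tape :: "word \<Rightarrow> int \<Rightarrow> nat" where
  "word_tape w i = (if 0 \<le> i \<and> i < int (length w) then w ! nat i else 0)"

fun shift :: "move \<Rightarrow> int" where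
  "shift Move_Left = -1"
| "shift Stay = 0"
| "shift Move_Right = 1"

fun act :: "nat \<times> move \<Rightarrow> tape \<Rightarrow> tape" where
  "act (s, m) (c, p) = (c(p := s), p + shift m)"

fun step :: "tm \<Rightarrow> config \<Rightarrow> config" where
  "step M (q, tps) =
     (if q = n_states M then (q, tps)
      else case delta M q (map (\<lambda>(c, p). c p) tps) of (q', acts) \<Rightarrow> (q', map2 act acts tps))"

definition start_config :: "tm \<Rightarrow> word \<Rightarrow> config" where
  "start_config M w = (0, (word_tape w, 0) # replicate (n_tapes M - 1) (word_tape [], 0))"

definition outputs_within :: "tm \<Rightarrow> word \<Rightarrow> word \<Rightarrow> nat \<Rightarrow> bool" where
  "outputs_within M w v T \<longleftrightarrow>
     (\<exists>t \<le> T. case (step M ^^ t) (start_config M w) of (q, tps) \<Rightarrow>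
        q = n_states M \<and> fst (last tps) = word_tape v)"

section \<open>Decision problems and polynomial-time reductions\<close>

record 'x problem =
  instances :: "'x set"
  encode :: "'x \<Rightarrow> word"
  yes :: "'x \<Rightarrow> bool"

definition poly_time_computable :: "'x set \<Rightarrow> ('x \<Rightarrow> word) \<Rightarrow> ('y \<Rightarrow> word) \<Rightarrow> ('x \<Rightarrow> 'y) \<Rightarrow> bool" where
  "poly_time_computable X enc enc' f \<longleftrightarrow>
     (\<exists>M (p :: nat poly). wf_tm M \<and>
        (\<forall>x \<in> X. set (enc x) \<subseteq> {1..<n_symbols M} \<and>
           outputs_within M (enc x) (enc' (f x)) (poly p (length (enc x)))))"

definition poly_reduces :: "'x problem \<Rightarrow> 'y problem \<Rightarrow> bool" where
  "poly_reduces P Q \<longleftrightarrow>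
     (\<exists>f \<in> instances P \<rightarrow> instances Q.
        poly_time_computable (instances P) (encode P) (encode Q) f \<and>
        (\<forall>x \<in> instances P. yes P x \<longleftrightarrow> yes Q (f x)))"

definition poly_equivalent :: "'x problem \<Rightarrow> 'y problem \<Rightarrow> bool" where
  "poly_equivalent P Q \<longleftrightarrow> poly_reduces P Q \<and> poly_reduces Q P"

section \<open>The problem MP\<close>

text \<open>An instance has domain \<open>{..<n}\<close>, as is usual for encoded finite structures. It is
  written as \<open>n\<close> in unary (letter 4), followed by the full value table of each relation, with
  the tuples in lexicographic order.\<close>

fun value_letter :: "pstar \<Rightarrow> nat" where
  "value_letter Zero = 1"
| "value_letter One = 2"
| "value_letter Star = 3"

definition encode_structure :: "signature \<Rightarrow> (pstar, nat) pstructure \<Rightarrow> word" where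
  "encode_structure \<sigma> G =
     (let n = card (univ G) in
      replicate n 4 @
      concat (map (\<lambda>i. map (\<lambda>t. value_letter (rel G i t)) (product_lists (replicate (\<sigma> ! i) [0..<n])))
        [0..<length \<sigma>]))"

definition MP :: "signature \<Rightarrow> (pstar, 'a) pstructure \<Rightarrow> (pstar, nat) pstructure problem" where
  "MP \<sigma> A =
     \<lparr>instances = {G. \<exists>n. univ G = {..<n}},
      encode = encode_structure \<sigma>,
      yes = (\<lambda>G. \<exists>h. is_hom \<sigma> G A h)\<rparr>"

end

theory Submission
  imports Defs
begin

section \<open>Machine programs\<close>

text \<open>A program is a number of control states together with a transition table; it starts in
  state 0 and is left through the first state number beyond its own. Sequencing therefore only
  shifts the second table, and a loop only redirects the exit of its body.\<close>

text \<open>The combinatorics is short; the obstacle is that reducibility refers to concrete Turing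
  machines. The lexicographic order of the tables keeps this manageable: for
  \<open>k = 2 + r\<close> the table of \<open>R_1\<close> consists of \<open>n ^ 2\<close>
  consecutive blocks of length \<open>n ^ r\<close>, one per pair of leading entries. Turning a
  graph into a structure means repeating each letter \<open>n ^ r\<close> times, and the converse
  replaces each block by the join of its letters. No position is ever computed, so loops of length
  \<open>n\<close> are the only control needed, and since arities are constants their nesting depth
  is fixed and the time polynomial. The five symbols are the blank, the three value letters and the
  unary letter 4.\<close>

type_synonym prog = "nat \<times> (nat \<Rightarrow> nat list \<Rightarrow> nat \<times> (nat \<times> move) list)"

definition wf_prog :: "nat \<Rightarrow> nat \<Rightarrow> prog \<Rightarrow> bool" where
  "wf_prog d g p \<longleftrightarrow> (\<forall>q < fst p. \<forall>xs \<in> tuples d {..<g}.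
     fst (snd p q xs) \<le> fst p \<and> length (snd (snd p q xs)) = d \<and>
     (\<forall>a \<in> set (snd (snd p q xs)). fst a < g))"

definition pstep :: "prog \<Rightarrow> config \<Rightarrow> config" where
  "pstep p c = (case snd p (fst c) (map (\<lambda>(c, i). c i) (snd c)) of
     (q', acts) \<Rightarrow> (q', map2 act acts (snd c)))"

inductive exec :: "prog \<Rightarrow> config \<Rightarrow> nat \<Rightarrow> config \<Rightarrow> bool" for p where
  exec_refl: "exec p c 0 c"
| exec_step: "fst c < fst p \<Longrightarrow> exec p (pstep p c) t c' \<Longrightarrow> exec p c (Suc t) c'"

lemma exec_trans: "exec p c t c' \<Longrightarrow> exec p c' t' c'' \<Longrightarrow> exec p c (t + t') c''"
  by (induction rule: exec.induct) (auto intro: exec.intros)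

text \<open>Embedding a program into a larger one renames its states by \<open>\<phi>\<close>;
  matching single steps suffices, and the running time is unchanged. No match is demanded at the
  exit of \<open>p\<close>, where the larger program goes on in its own way.\<close>

lemma exec_simulate:
  assumes "exec p c t c'"
    and "\<And>c. fst c < fst p \<Longrightarrow>
      fst (map_prod \<phi> id c) < fst p' \<and> pstep p' (map_prod \<phi> id c) = map_prod \<phi> id (pstep p c)"
  shows "exec p' (map_prod \<phi> id c) t (map_prod \<phi> id c')"
  using assms(1)
proof (induction rule: exec.induct)
  case (exec_step c t c')
  show ?case
    using assms(2)[OF exec_step.hyps(1)] exec_step.IH by (metis exec.exec_step)
qed (rule exec_refl)

subsection \<open>Combinators\<close>

definition skip :: prog where
  "skip = (0, \<lambda>q xs. (0, []))"

definition prim :: "nat \<Rightarrow> (nat list \<Rightarrow> nat \<Rightarrow> nat \<times> move) \<Rightarrow> prog" where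
  "prim d F = (1, \<lambda>q xs. (1, map (F xs) [0..<d]))"

definition seq :: "prog \<Rightarrow> prog \<Rightarrow> prog" where
  "seq p p' = (fst p + fst p', \<lambda>q xs. if q < fst p then snd p q xs
     else apfst ((+) (fst p)) (snd p' (q - fst p) xs))"

definition while_state :: "prog \<Rightarrow> nat \<Rightarrow> nat" where
  "while_state p q = (if q = fst p then 0 else Suc q)"

definition while :: "nat \<Rightarrow> nat set \<Rightarrow> prog \<Rightarrow> prog" where
  "while j S p = (Suc (fst p), \<lambda>q xs.
     if q = 0 then (if xs ! j \<in> S then while_state p 0 else Suc (fst p), map (\<lambda>x. (x, Stay)) xs)
     else apfst (while_state p) (snd p (q - 1) xs))"

lemma fst_while [simp]: "fst (while j S p) = Suc (fst p)"
  by (simp add: while_def)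

lemma wf_skip: "wf_prog d g skip"
  by (simp add: wf_prog_def skip_def)

lemma wf_prim:
  assumes "\<And>xs i. xs \<in> tuples d {..<g} \<Longrightarrow> i < d \<Longrightarrow> fst (F xs i) < g"
  shows "wf_prog d g (prim d F)"
  using assms by (fastforce simp: wf_prog_def prim_def)

lemma wf_seq:
  assumes "wf_prog d g p" and "wf_prog d g p'"
  shows "wf_prog d g (seq p p')"
  unfolding wf_prog_def
proof (intro allI impI ballI)
  fix q xs assume "q < fst (seq p p')" and "xs \<in> tuples d {..<g}"
  then show "fst (snd (seq p p') q xs) \<le> fst (seq p p') \<and> length (snd (snd (seq p p') q xs)) = d \<and>
     (\<forall>a \<in> set (snd (snd (seq p p') q xs)). fst a < g)"
    using assms[unfolded wf_prog_def, rule_format, of "q - fst p" xs]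
      assms(1)[unfolded wf_prog_def, rule_format, of q xs]
    by (cases "q < fst p") (auto simp: seq_def)
qed

lemma wf_while:
  assumes "wf_prog d g p"
  shows "wf_prog d g (while j S p)"
  unfolding wf_prog_def
proof (intro allI impI ballI)
  fix q xs assume "q < fst (while j S p)" and "xs \<in> tuples d {..<g}"
  then show "fst (snd (while j S p) q xs) \<le> fst (while j S p) \<and>
     length (snd (snd (while j S p) q xs)) = d \<and>
     (\<forall>a \<in> set (snd (snd (while j S p) q xs)). fst a < g)"
    using assms[unfolded wf_prog_def, rule_format, of "q - 1" xs]
    by (cases "q = 0") (auto simp: while_def while_state_def tuples_def)
qed

text \<open>Tape contents are passed as functions of the tape number, which turns updates of single
  tapes into function updates.\<close>

definition runs :: "nat \<Rightarrow> prog \<Rightarrow> (nat \<Rightarrow> tape) \<Rightarrow> nat \<Rightarrow> (nat \<Rightarrow> tape) \<Rightarrow> bool" where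
  "runs d p \<tau> T \<tau>' \<longleftrightarrow> (\<exists>t \<le> T. exec p (0, map \<tau> [0..<d]) t (fst p, map \<tau>' [0..<d]))"

abbreviation scan :: "tape \<Rightarrow> nat" where
  "scan t \<equiv> fst t (snd t)"

lemma act_eq: "act a t = ((fst t)(snd t := fst a), snd t + shift (snd a))"
  by (cases a; cases t) simp

section \<open>Time-bounded rules for the combinators\<close>

lemma runs_mono: "runs d p \<tau> T \<tau>' \<Longrightarrow> T \<le> T' \<Longrightarrow> runs d p \<tau> T' \<tau>'"
  by (auto simp: runs_def intro: order_trans)

lemma runs_cong:
  assumes "runs d p \<tau> T \<tau>'" and "\<And>i. i < d \<Longrightarrow> \<tau> i = \<upsilon> i" and "\<And>i. i < d \<Longrightarrow> \<tau>' i = \<upsilon>' i"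
    and "T \<le> T'"
  shows "runs d p \<upsilon> T' \<upsilon>'"
proof -
  have "map \<tau> [0..<d] = map \<upsilon> [0..<d]" "map \<tau>' [0..<d] = map \<upsilon>' [0..<d]"
    using assms(2,3) by simp_all
  then have "runs d p \<upsilon> T \<upsilon>'" using assms(1) by (simp only: runs_def)
  then show ?thesis using assms(4) by (rule runs_mono)
qed

lemma runs_skip: "runs d skip \<tau> 0 \<tau>"
  by (auto simp: runs_def skip_def intro: exec_refl)

lemma runs_prim:
  "runs d (prim d F) \<tau> 1 (\<lambda>i. act (F (map (\<lambda>i. scan (\<tau> i)) [0..<d]) i) (\<tau> i))"
proof -
  have "pstep (prim d F) (0, map \<tau> [0..<d]) =
      (1, map (\<lambda>i. act (F (map (\<lambda>i. scan (\<tau> i)) [0..<d]) i) (\<tau> i)) [0..<d])"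
    by (auto simp: pstep_def prim_def comp_def case_prod_beta intro!: nth_equalityI)
  then have "exec (prim d F) (0, map \<tau> [0..<d]) (Suc 0)
      (1, map (\<lambda>i. act (F (map (\<lambda>i. scan (\<tau> i)) [0..<d]) i) (\<tau> i)) [0..<d])"
    by (intro exec_step) (simp_all add: prim_def exec_refl)
  then show ?thesis by (auto simp: runs_def prim_def)
qed

lemma runs_seq:
  assumes "runs d p \<tau> T \<tau>'" and "runs d p' \<tau>' T' \<tau>''"
  shows "runs d (seq p p') \<tau> (T + T') \<tau>''"
proof -
  obtain t t' where t: "t \<le> T" "exec p (0, map \<tau> [0..<d]) t (fst p, map \<tau>' [0..<d])"
    and t': "t' \<le> T'" "exec p' (0, map \<tau>' [0..<d]) t' (fst p', map \<tau>'' [0..<d])"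
    using assms unfolding runs_def by blast
  have "exec (seq p p') (map_prod id id (0, map \<tau> [0..<d])) t
      (map_prod id id (fst p, map \<tau>' [0..<d]))"
    by (rule exec_simulate[OF t(2)])
      (auto simp: seq_def pstep_def map_prod_def split: prod.splits)
  moreover have "exec (seq p p') (map_prod ((+) (fst p)) id (0, map \<tau>' [0..<d])) t'
      (map_prod ((+) (fst p)) id (fst p', map \<tau>'' [0..<d]))"
    by (rule exec_simulate[OF t'(2)])
      (auto simp: seq_def pstep_def map_prod_def split: prod.splits)
  ultimately have "exec (seq p p') (0, map \<tau> [0..<d]) (t + t') (fst p + fst p', map \<tau>'' [0..<d])"
    by (auto intro: exec_trans)
  moreover have "t + t' \<le> T + T'" using t t' by simp
  ultimately show ?thesis by (auto simp: runs_def seq_def)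
qed

lemma pstep_while_test:
  assumes "j < d"
  shows "pstep (while j S p) (0, map \<tau> [0..<d]) =
    (if scan (\<tau> j) \<in> S then while_state p 0 else Suc (fst p), map \<tau> [0..<d])"
proof -
  have "map2 act (map (\<lambda>x. (x, Stay)) (map (\<lambda>(c, i). c i) (map \<tau> [0..<d]))) (map \<tau> [0..<d])
      = map \<tau> [0..<d]"
    by (rule nth_equalityI) (auto simp: act_eq case_prod_beta)
  then show ?thesis using assms
    by (simp add: pstep_def while_def case_prod_beta)
qed

lemma runs_while_stop:
  assumes "j < d" and "scan (\<tau> j) \<notin> S"
  shows "runs d (while j S p) \<tau> 1 \<tau>"
proof -
  have "exec (while j S p) (0, map \<tau> [0..<d]) (Suc 0) (Suc (fst p), map \<tau> [0..<d])"
    using assms by (intro exec_step) (simp_all add: pstep_while_test exec_refl)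
  then show ?thesis by (auto simp: runs_def)
qed

lemma runs_while_continue:
  assumes "j < d" and "scan (\<tau> j) \<in> S"
    and "runs d p \<tau> T \<tau>'" and "runs d (while j S p) \<tau>' T' \<tau>''"
  shows "runs d (while j S p) \<tau> (Suc (T + T')) \<tau>''"
proof -
  let ?w = "while j S p"
  obtain t t' where t: "t \<le> T" "exec p (0, map \<tau> [0..<d]) t (fst p, map \<tau>' [0..<d])"
    and t': "t' \<le> T'" "exec ?w (0, map \<tau>' [0..<d]) t' (fst ?w, map \<tau>'' [0..<d])"
    using assms unfolding runs_def by blast
  have "exec ?w (map_prod (while_state p) id (0, map \<tau> [0..<d])) t
      (map_prod (while_state p) id (fst p, map \<tau>' [0..<d]))"
    by (rule exec_simulate[OF t(2)])
      (auto simp: while_def while_state_def pstep_def map_prod_def split: prod.splits)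
  then have "exec ?w (while_state p 0, map \<tau> [0..<d]) t (0, map \<tau>' [0..<d])"
    by (simp add: while_state_def)
  from exec_trans[OF this t'(2)]
  have "exec ?w (0, map \<tau> [0..<d]) (Suc (t + t')) (fst ?w, map \<tau>'' [0..<d])"
    using assms by (intro exec_step) (simp_all add: pstep_while_test)
  moreover have "Suc (t + t') \<le> Suc (T + T')" using t t' by simp
  ultimately show ?thesis unfolding runs_def by blast
qed

text \<open>\<open>runs_while_continue\<close> prepends a round, so the induction is on the number
  \<open>m\<close> of rounds still to go. Each round costs the body and one test; the final 1 is the
  failing test.\<close>

lemma runs_while_iterate:
  assumes "j < d"
    and "\<And>i. i < n \<Longrightarrow> scan (\<tau> i j) \<in> S" and "scan (\<tau> n j) \<notin> S"
    and "\<And>i. i < n \<Longrightarrow> runs d p (\<tau> i) T (\<tau> (Suc i))"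
  shows "runs d (while j S p) (\<tau> 0) (n * Suc T + 1) (\<tau> n)"
proof -
  have "runs d (while j S p) (\<tau> (n - m)) (m * Suc T + 1) (\<tau> n)" if "m \<le> n" for m
    using that
  proof (induction m)
    case 0
    then show ?case using runs_while_stop[of j d "\<tau> n" S p] assms by simp
  next
    case (Suc m)
    have "runs d p (\<tau> (n - Suc m)) T (\<tau> (n - m))"
      using assms(4)[of "n - Suc m"] Suc.prems by (simp add: Suc_diff_Suc)
    with Suc have "runs d (while j S p) (\<tau> (n - Suc m)) (Suc (T + (m * Suc T + 1))) (\<tau> n)"
      using assms(2)[of "n - Suc m"] by (intro runs_while_continue[OF assms(1)]) auto
    then show ?case by (rule runs_mono) simp
  qed
  from this[of n] show ?thesis by simp
qed

subsection \<open>Moving one head and rewinding a counter\<close>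

definition move_head :: "nat \<Rightarrow> nat \<Rightarrow> move \<Rightarrow> prog" where
  "move_head d j m = prim d (\<lambda>xs i. (xs ! i, if i = j then m else Stay))"

lemma tuples_nth_less: "xs \<in> tuples d {..<g} \<Longrightarrow> i < d \<Longrightarrow> xs ! i < g"
  unfolding tuples_def using nth_mem by fastforce

lemma wf_move_head: "wf_prog d g (move_head d j m)"
  unfolding move_head_def by (rule wf_prim) (simp add: tuples_nth_less)

lemma runs_move_head:
  "runs d (move_head d j m) \<tau> 1 (\<tau>(j := (fst (\<tau> j), snd (\<tau> j) + shift m)))"
  unfolding move_head_def
  by (rule runs_cong[OF runs_prim]) (auto simp: act_eq)

abbreviation counter :: "nat \<Rightarrow> int \<Rightarrow> nat" where
  "counter n \<equiv> word_tape (replicate n 4)"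

lemma counter_eq: "counter n i = (if 0 \<le> i \<and> i < int n then 4 else 0)"
  by (auto simp: word_tape_def)

text \<open>The head arrives on cell \<open>n\<close>, which is blank, so a step left must precede
  the loop. The loop then stops on the blank cell -1, and a step right leads to cell 0; this also
  works for \<open>n = 0\<close>.\<close>

definition rewind :: "nat \<Rightarrow> nat \<Rightarrow> prog" where
  "rewind d j = seq (move_head d j Move_Left)
     (seq (while j (- {0}) (move_head d j Move_Left)) (move_head d j Move_Right))"

lemma wf_rewind: "wf_prog d g (rewind d j)"
  unfolding rewind_def by (intro wf_seq wf_while wf_move_head)

lemma runs_rewind:
  assumes "j < d"
  shows "runs d (rewind d j) (\<tau>(j := (counter n, int n))) (2 * n + 3) (\<tau>(j := (counter n, 0)))"
proof -
  let ?at = "\<lambda>i::int. \<tau>(j := (counter n, i))"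
  have "runs d (while j (- {0}) (move_head d j Move_Left))
      (?at (int n - 1 - int 0)) (n * Suc 1 + 1) (?at (int n - 1 - int n))"
    using assms
    by (intro runs_while_iterate[where \<tau> = "\<lambda>i. ?at (int n - 1 - int i)"])
      (auto simp: counter_eq intro!: runs_cong[OF runs_move_head])
  then have loop: "runs d (while j (- {0}) (move_head d j Move_Left))
      (?at (int n - 1)) (n * Suc 1 + 1) (?at (- 1))" by simp
  have "runs d (move_head d j Move_Left) (?at (int n)) 1 (?at (int n - 1))"
    "runs d (move_head d j Move_Right) (?at (- 1)) 1 (?at 0)"
    by (auto intro!: runs_cong[OF runs_move_head])
  with loop have "runs d (rewind d j) (?at (int n)) (1 + ((n * Suc 1 + 1) + 1)) (?at 0)"
    unfolding rewind_def by (blast intro: runs_seq)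
  then show ?thesis by (rule runs_mono) simp
qed

section \<open>Transformations of the input and output tape in polynomial time\<close>

text \<open>Tape 0 is the input, tape \<open>K + 1\<close> the output, and the tapes in between hold \<open>n\<close> in unary.
  Running a body once per cell of such a counter iterates it \<open>n\<close> times, so that \<open>k\<close> nested
  loops on different counters iterate it \<open>n ^ k\<close> times.\<close>

definition layout :: "nat \<Rightarrow> nat \<Rightarrow> (nat \<Rightarrow> int) \<Rightarrow> tape \<times> tape \<Rightarrow> nat \<Rightarrow> tape" where
  "layout K n pos s i =
     (if i = 0 then fst s else if i = Suc K then snd s else (counter n, pos i))"

text \<open>The counters \<open>1..k\<close> are free for use: they are found at 0 and handed back
  there. The other positions are arbitrary, since enclosing loops may be in progress on those tapes.
  One program and one time bound serve all \<open>n\<close>.\<close>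

definition realizable :: "nat \<Rightarrow> nat \<Rightarrow> (nat \<Rightarrow> tape \<times> tape \<Rightarrow> tape \<times> tape) \<Rightarrow> bool" where
  "realizable K k f \<longleftrightarrow> (\<exists>p r. wf_prog (K + 2) 5 p \<and>
     (\<forall>n pos s. (\<forall>j \<in> {1..k}. pos j = 0) \<longrightarrow>
        runs (K + 2) p (layout K n pos s) (poly r n) (layout K n pos (f n s))))"

lemma realizable_mono: "realizable K k f \<Longrightarrow> k \<le> k' \<Longrightarrow> realizable K k' f"
  unfolding realizable_def by (meson atLeastAtMost_iff order_trans)

lemma realizable_id: "realizable K k (\<lambda>n s. s)"
  unfolding realizable_def
  by (intro exI[of _ skip] exI[of _ 0]) (simp add: wf_skip runs_skip)

lemma realizable_seq:
  assumes "realizable K k f" and "realizable K k g"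
  shows "realizable K k (\<lambda>n s. g n (f n s))"
proof -
  obtain p r p' r' where
    p: "wf_prog (K + 2) 5 p" "\<And>n pos s. (\<forall>j \<in> {1..k}. pos j = 0) \<Longrightarrow>
        runs (K + 2) p (layout K n pos s) (poly r n) (layout K n pos (f n s))" and
    p': "wf_prog (K + 2) 5 p'" "\<And>n pos s. (\<forall>j \<in> {1..k}. pos j = 0) \<Longrightarrow>
        runs (K + 2) p' (layout K n pos s) (poly r' n) (layout K n pos (g n s))"
    using assms unfolding realizable_def by blast
  have "runs (K + 2) (seq p p') (layout K n pos s) (poly (r + r') n) (layout K n pos (g n (f n s)))"
    if "\<forall>j \<in> {1..k}. pos j = 0" for n pos s
    using runs_seq[OF p(2)[OF that] p'(2)[OF that]] by simp
  with wf_seq[OF p(1) p'(1)] show ?thesis unfolding realizable_def by blast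
qed

definition io_step :: "(nat \<Rightarrow> nat \<Rightarrow> (nat \<times> move) \<times> (nat \<times> move)) \<Rightarrow> tape \<times> tape \<Rightarrow> tape \<times> tape" where
  "io_step F s = (case F (scan (fst s)) (scan (snd s)) of (a, b) \<Rightarrow> (act a (fst s), act b (snd s)))"

lemma realizable_io_step:
  assumes "\<And>x y. x < 5 \<Longrightarrow> y < 5 \<Longrightarrow> fst (fst (F x y)) < 5 \<and> fst (snd (F x y)) < 5"
  shows "realizable K k (\<lambda>n. io_step F)"
proof -
  let ?G = "\<lambda>xs i. if i = 0 then fst (F (xs ! 0) (xs ! Suc K))
    else if i = Suc K then snd (F (xs ! 0) (xs ! Suc K)) else (xs ! i, Stay)"
  have "wf_prog (K + 2) 5 (prim (K + 2) ?G)"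
    by (rule wf_prim) (simp add: tuples_nth_less assms)
  moreover have "runs (K + 2) (prim (K + 2) ?G) (layout K n pos s) (poly 1 n)
      (layout K n pos (io_step F s))" for n pos s
    by (rule runs_cong[OF runs_prim])
      (auto simp: layout_def io_step_def act_eq case_prod_beta nth_append simp del: upt_Suc)
  ultimately show ?thesis unfolding realizable_def by blast
qed

text \<open>Counter \<open>Suc k\<close> drives the loop, its head position being the number of
  completed rounds. The body may use only the counters below it, and the final rewind makes the loop
  reusable as a body.\<close>

lemma realizable_loop:
  assumes "realizable K k f" and "k < K"
  shows "realizable K (Suc k) (\<lambda>n. f n ^^ n)"
proof -
  let ?j = "Suc k"
  obtain p r where
    p: "wf_prog (K + 2) 5 p" "\<And>n pos s. (\<forall>j \<in> {1..k}. pos j = 0) \<Longrightarrow>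
        runs (K + 2) p (layout K n pos s) (poly r n) (layout K n pos (f n s))"
    using assms unfolding realizable_def by blast
  let ?body = "seq p (move_head (K + 2) ?j Move_Right)"
  let ?p = "seq (while ?j (- {0}) ?body) (rewind (K + 2) ?j)"
  \<comment> \<open>\<open>[:0, 1:]\<close> is the monomial. Each round adds a head move and a test
    to \<open>r\<close>, and the rewind adds 2 per cell; the constant 4 is 1 for the failing test
    and 3 for the rewind.\<close>
  let ?r = "[:0, 1:] * (r + [:4:]) + [:4:]"
  have "runs (K + 2) ?p (layout K n pos s) (poly ?r n) (layout K n pos ((f n ^^ n) s))"
    if pos: "\<forall>j \<in> {1..?j}. pos j = 0" for n pos s
  proof -
    let ?at = "\<lambda>i. layout K n (pos(?j := int i)) ((f n ^^ i) s)"
    have body: "runs (K + 2) ?body (?at i) (poly r n + 1) (?at (Suc i))" for i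
    proof (rule runs_seq)
      show "runs (K + 2) p (?at i) (poly r n) (layout K n (pos(?j := int i)) ((f n ^^ Suc i) s))"
        using p(2)[of "pos(?j := int i)" n "(f n ^^ i) s"] pos by simp
      show "runs (K + 2) (move_head (K + 2) ?j Move_Right)
          (layout K n (pos(?j := int i)) ((f n ^^ Suc i) s)) 1 (?at (Suc i))"
        by (rule runs_cong[OF runs_move_head]) (use assms(2) in \<open>auto simp: layout_def\<close>)
    qed
    have loop: "runs (K + 2) (while ?j (- {0}) ?body) (?at 0) (n * Suc (poly r n + 1) + 1) (?at n)"
      by (rule runs_while_iterate[where \<tau> = ?at, OF _ _ _ body])
        (use assms(2) in \<open>auto simp: layout_def counter_eq\<close>)
    have start: "?at 0 = layout K n pos s"
      using pos by (auto simp: fun_upd_idem)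
    have "runs (K + 2) (rewind (K + 2) ?j) (?at n) (2 * n + 3)
        (layout K n pos ((f n ^^ n) s))"
      by (rule runs_cong[OF runs_rewind[of ?j "K + 2" "layout K n pos ((f n ^^ n) s)" n]])
        (use assms(2) pos in \<open>auto simp: layout_def\<close>)
    from runs_seq[OF loop this, unfolded start]
    show ?thesis by (rule runs_mono) (simp add: algebra_simps)
  qed
  moreover have "wf_prog (K + 2) 5 ?p"
    by (intro wf_seq wf_while wf_rewind wf_move_head p(1))
  ultimately show ?thesis unfolding realizable_def by blast
qed

lemma realizable_power:
  assumes "realizable K 0 f" and "k \<le> K"
  shows "realizable K k (\<lambda>n. f n ^^ (n ^ k))"
  using assms(2)
proof (induction k)
  case (Suc k)
  then have "realizable K (Suc k) (\<lambda>n. (f n ^^ (n ^ k)) ^^ n)"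
    by (intro realizable_loop) auto
  then show ?case by (simp add: funpow_mult mult.commute)
qed (use assms(1) in simp)

text \<open>Serves bodies that already occupy \<open>k\<close> counters, which
  \<open>realizable_power\<close> excludes: the outer loop visits the \<open>n ^ 2\<close> blocks
  while the body runs through one block.\<close>

lemma realizable_square:
  assumes "realizable K k f" and "Suc (Suc k) \<le> K"
  shows "realizable K (Suc (Suc k)) (\<lambda>n. f n ^^ (n ^ 2))"
proof -
  have "realizable K (Suc (Suc k)) (\<lambda>n. (f n ^^ n) ^^ n)"
    using assms by (intro realizable_loop) auto
  then show ?thesis by (simp add: funpow_mult power2_eq_square)
qed

text \<open>The powers are handled one after the other on the same counters, since each phase
  returns them to 0.\<close>

lemma realizable_sum_powers:
  assumes "realizable K 0 f" and "\<And>k. k \<in> set ks \<Longrightarrow> k \<le> K"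
  shows "realizable K K (\<lambda>n. f n ^^ (\<Sum>k\<leftarrow>ks. n ^ k))"
  using assms(2)
proof (induction ks)
  case Nil
  then show ?case using realizable_id by simp
next
  case (Cons k ks)
  have "realizable K K (\<lambda>n. f n ^^ (\<Sum>k\<leftarrow>ks. n ^ k))" "realizable K K (\<lambda>n. f n ^^ (n ^ k))"
    using Cons by (auto intro: realizable_mono[OF realizable_power[OF assms(1)]])
  then have "realizable K K (\<lambda>n s. (f n ^^ (n ^ k)) ((f n ^^ (\<Sum>k\<leftarrow>ks. n ^ k)) s))"
    by (rule realizable_seq)
  then show ?case by (simp add: funpow_add comp_def)
qed

subsection \<open>Initialising the counters\<close>

text \<open>The head waits on the first cell after the word, so that writing and moving right
  appends a letter.\<close>

abbreviation written :: "word \<Rightarrow> tape" where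
  "written v \<equiv> (word_tape v, int (length v))"

lemma word_tape_snoc: "(word_tape v)(int (length v) := a) = word_tape (v @ [a])"
  by (auto simp: word_tape_def fun_eq_iff nth_append)

fun rewind_all :: "nat \<Rightarrow> nat \<Rightarrow> prog" where
  "rewind_all d 0 = skip"
| "rewind_all d (Suc k) = seq (rewind d (Suc k)) (rewind_all d k)"

lemma wf_rewind_all: "wf_prog d g (rewind_all d k)"
  by (induction k) (simp_all add: wf_skip wf_seq wf_rewind)

lemma runs_rewind_all:
  assumes "k \<le> K"
  shows "runs (K + 2) (rewind_all (K + 2) k) (layout K n (\<lambda>i. if i \<le> k then int n else 0) s)
    (k * (2 * n + 3)) (layout K n (\<lambda>i. 0) s)"
  using assms
proof (induction k)
  case 0
  show ?case unfolding rewind_all.simps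
    by (rule runs_cong[OF runs_skip]) (auto simp: layout_def)
next
  case (Suc k)
  have "runs (K + 2) (rewind (K + 2) (Suc k)) (layout K n (\<lambda>i. if i \<le> Suc k then int n else 0) s)
     (2 * n + 3) (layout K n (\<lambda>i. if i \<le> k then int n else 0) s)"
    by (rule runs_cong[OF runs_rewind[of "Suc k" "K + 2"
            "layout K n (\<lambda>i. if i \<le> k then int n else 0) s" n]])
      (use Suc.prems in \<open>auto simp: layout_def\<close>)
  from runs_seq[OF this Suc.IH] show ?case using Suc.prems by simp
qed

text \<open>The copy goes to the output tape as well: both reductions keep the domain, so the unary
  prefix of the result is then complete. Only the counters are rewound; the input head stays on the
  first table letter.\<close>

definition init_counters :: "nat \<Rightarrow> prog" where
  "init_counters K =
     seq (while 0 {4} (prim (K + 2) (\<lambda>xs i. (if i = 0 then xs ! i else 4, Move_Right))))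
       (rewind_all (K + 2) K)"

lemma wf_init_counters: "wf_prog (K + 2) 5 (init_counters K)"
  unfolding init_counters_def
  by (intro wf_seq wf_while wf_prim wf_rewind_all) (simp add: tuples_nth_less)

lemma runs_init_counters:
  assumes "\<And>i. 0 \<le> i \<Longrightarrow> i < int n \<Longrightarrow> c i = 4" and "c (int n) \<noteq> 4"
  shows "runs (K + 2) (init_counters K) (\<lambda>i. if i = 0 then (c, 0) else written [])
    (poly [:3 * K + 1, 2 * K + 2:] n)
    (layout K n (\<lambda>i. 0) ((c, int n), written (replicate n 4)))"
proof -
  let ?at = "\<lambda>m i. if i = 0 then (c, int m) else written (replicate m 4)"
  let ?copy = "prim (K + 2) (\<lambda>xs i. (if i = 0 then xs ! i else 4, Move_Right))"
  have "runs (K + 2) ?copy (?at m) 1 (?at (Suc m))" for m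
    by (rule runs_cong[OF runs_prim])
      (use word_tape_snoc[of "replicate m 4" 4] in
        \<open>auto simp: act_eq replicate_append_same simp del: upt_Suc\<close>)
  then have "runs (K + 2) (while 0 {4} ?copy) (?at 0) (n * Suc 1 + 1) (?at n)"
    by (intro runs_while_iterate) (use assms in auto)
  moreover have "runs (K + 2) (rewind_all (K + 2) K) (?at n) (K * (2 * n + 3))
    (layout K n (\<lambda>i. 0) ((c, int n), written (replicate n 4)))"
    by (rule runs_cong[OF runs_rewind_all[of K K]]) (auto simp: layout_def)
  ultimately have "runs (K + 2) (init_counters K) (?at 0) (n * Suc 1 + 1 + K * (2 * n + 3))
    (layout K n (\<lambda>i. 0) ((c, int n), written (replicate n 4)))"
    unfolding init_counters_def by (rule runs_seq)
  then show ?thesis by (rule runs_cong) (auto simp: algebra_simps)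
qed

subsection \<open>From programs to Turing machines\<close>

definition tm_of :: "nat \<Rightarrow> nat \<Rightarrow> prog \<Rightarrow> tm" where
  "tm_of d g p = \<lparr>n_tapes = d, n_symbols = g, n_states = fst p, delta = snd p\<rparr>"

lemma steps_tm_of: "exec p c t c' \<Longrightarrow> (step (tm_of d g p) ^^ t) c = c'"
proof (induction rule: exec.induct)
  case (exec_step c t c')
  have "step (tm_of d g p) c = pstep p c"
    using exec_step.hyps(1) by (cases c) (simp add: tm_of_def pstep_def)
  with exec_step.IH show ?case by (simp add: funpow_swap1)
qed simp

text \<open>Coefficients in \<open>nat\<close> are nonnegative. This turns a time bound in
  \<open>n\<close> into one in the input length.\<close>

lemma poly_nat_mono: "m \<le> n \<Longrightarrow> poly (p :: nat poly) m \<le> poly p n"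
  by (induction p) (auto intro!: add_mono mult_mono)

text \<open>Interface to the machine model: it remains to compute \<open>f\<close> from the tapes as
  the initialisation leaves them. Only the final content of the output tape counts, hence the
  \<open>fst\<close>.\<close>

lemma poly_time_computable_if_realizable:
  assumes "realizable K K f"
    and enc: "\<And>x. x \<in> X \<Longrightarrow> \<exists>n L. enc x = replicate n 4 @ L \<and> set L \<subseteq> {1..3} \<and>
      fst (snd (f n ((word_tape (enc x), int n), written (replicate n 4)))) = word_tape (enc' (F x))"
  shows "poly_time_computable X enc enc' F"
proof -
  obtain p r where
    p: "wf_prog (K + 2) 5 p" "\<And>n pos s. (\<forall>j \<in> {1..K}. pos j = 0) \<Longrightarrow>
        runs (K + 2) p (layout K n pos s) (poly r n) (layout K n pos (f n s))"
    using assms(1) unfolding realizable_def by blast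
  let ?p = "seq (init_counters K) p"
  let ?M = "tm_of (K + 2) 5 ?p"
  let ?r = "[:3 * K + 1, 2 * K + 2:] + r"
  have "wf_prog (K + 2) 5 ?p" by (intro wf_seq wf_init_counters p(1))
  then have "wf_tm ?M" by (simp add: wf_tm_def wf_prog_def tm_of_def case_prod_beta)
  moreover have "set (enc x) \<subseteq> {1..<n_symbols ?M} \<and>
      outputs_within ?M (enc x) (enc' (F x)) (poly ?r (length (enc x)))" if x: "x \<in> X" for x
  proof -
    obtain n L where L: "enc x = replicate n 4 @ L" "set L \<subseteq> {1..3}" and
      out: "fst (snd (f n ((word_tape (enc x), int n), written (replicate n 4)))) = word_tape (enc' (F x))"
      using enc[OF x] by blast
    let ?s = "((word_tape (enc x), int n), written (replicate n 4))"
    \<comment> \<open>The cell after the prefix holds a value letter, or the blank if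
      \<open>L\<close> is empty, so the copying loop stops exactly there.\<close>
    have "word_tape (enc x) (int n) \<noteq> 4"
      using L(2) by (cases L) (auto simp: word_tape_def L(1) nth_append)
    moreover have "word_tape (enc x) i = 4" if "0 \<le> i" "i < int n" for i
      using that by (auto simp: word_tape_def L(1) nth_append)
    ultimately have "runs (K + 2) (init_counters K)
        (\<lambda>i. if i = 0 then (word_tape (enc x), 0) else written [])
        (poly [:3 * K + 1, 2 * K + 2:] n) (layout K n (\<lambda>i. 0) ?s)"
      by (intro runs_init_counters)
    from runs_seq[OF this p(2)] have "runs (K + 2) ?p
        (\<lambda>i. if i = 0 then (word_tape (enc x), 0) else written [])
        (poly ?r n) (layout K n (\<lambda>i. 0) (f n ?s))"
      by simp
    then obtain t where t: "t \<le> poly ?r n" and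
      "exec ?p (0, map (\<lambda>i. if i = 0 then (word_tape (enc x), 0) else written []) [0..<K + 2]) t
        (fst ?p, map (layout K n (\<lambda>i. 0) (f n ?s)) [0..<K + 2])"
      unfolding runs_def by blast
    from steps_tm_of[OF this(2)] have
      "(step ?M ^^ t) (0, map (\<lambda>i. if i = 0 then (word_tape (enc x), 0) else written []) [0..<K + 2]) =
        (fst ?p, map (layout K n (\<lambda>i. 0) (f n ?s)) [0..<K + 2])" .
    moreover have "map (\<lambda>i. if i = 0 then (word_tape (enc x), 0) else written []) [0..<K + 2] =
        (word_tape (enc x), 0) # replicate (K + 1) (word_tape [], 0)"
      by (rule nth_equalityI) (auto simp: nth_Cons split: nat.splits simp del: upt_Suc)
    ultimately have "(step ?M ^^ t) (start_config ?M (enc x)) =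
        (fst ?p, map (layout K n (\<lambda>i. 0) (f n ?s)) [0..<K + 2])"
      by (simp add: start_config_def tm_of_def)
    moreover have "fst (last (map (layout K n (\<lambda>i. 0) (f n ?s)) [0..<K + 2])) =
        word_tape (enc' (F x))"
      using out by (simp add: layout_def)
    moreover have "poly ?r n \<le> poly ?r (length (enc x))"
      by (rule poly_nat_mono) (simp add: L(1))
    moreover have "n_states ?M = fst ?p" by (simp add: tm_of_def)
    ultimately have "outputs_within ?M (enc x) (enc' (F x)) (poly ?r (length (enc x)))"
      unfolding outputs_within_def using t
      by (intro exI[of _ t] conjI) (auto simp del: poly_add intro: order_trans)
    moreover have "set (enc x) \<subseteq> {1..<n_symbols ?M}"
      using L by (auto simp: tm_of_def)
    ultimately show ?thesis by blast
  qed
  ultimately show ?thesis unfolding poly_time_computable_def by blast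
qed

section \<open>Reading and writing value tables\<close>

text \<open>A local condition on the tape, so that whatever follows the word, such as the tables of
  further relations, is left open.\<close>

fun reads :: "(int \<Rightarrow> nat) \<Rightarrow> int \<Rightarrow> word \<Rightarrow> bool" where
  "reads c i [] \<longleftrightarrow> True"
| "reads c i (a # w) \<longleftrightarrow> c i = a \<and> reads c (i + 1) w"

lemma reads_append: "reads c i (v @ w) \<longleftrightarrow> reads c i v \<and> reads c (i + int (length v)) w"
  by (induction v arbitrary: i) (auto simp: algebra_simps)

lemma reads_iff: "reads c i w \<longleftrightarrow> (\<forall>j < length w. c (i + int j) = w ! j)"
  by (induction w arbitrary: i) (simp_all add: All_less_Suc2 algebra_simps)

lemma reads_word_tape: "reads (word_tape (u @ v @ w)) (int (length u)) v"
  by (auto simp: reads_iff word_tape_def nth_append nat_add_distrib)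

subsection \<open>Copying\<close>

text \<open>Letter 1 encodes \<open>Zero\<close>, the value of all padded relations.\<close>

definition write_one :: "tape \<times> tape \<Rightarrow> tape \<times> tape" where
  "write_one = io_step (\<lambda>a b. ((a, Stay), (1, Move_Right)))"

definition copy_letter :: "tape \<times> tape \<Rightarrow> tape \<times> tape" where
  "copy_letter = io_step (\<lambda>a b. ((a, Stay), (a, Move_Right)))"

definition next_input :: "tape \<times> tape \<Rightarrow> tape \<times> tape" where
  "next_input = io_step (\<lambda>a b. ((a, Move_Right), (b, Stay)))"

lemma write_one_written: "write_one (t, written v) = (t, written (v @ [1]))"
  by (simp add: write_one_def io_step_def act_eq word_tape_snoc)

lemma write_one_power: "(write_one ^^ m) (t, written v) = (t, written (v @ replicate m 1))"
  by (induction m) (simp_all only: funpow.simps o_apply write_one_written append_assoc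
      replicate_append_same replicate.simps append_Nil2 id_apply)

lemma copy_letter_written: "copy_letter (t, written v) = (t, written (v @ [scan t]))"
  by (simp add: copy_letter_def io_step_def act_eq word_tape_snoc)

lemma copy_letter_power:
  "(copy_letter ^^ m) (t, written v) = (t, written (v @ replicate m (scan t)))"
  by (induction m) (simp_all only: funpow.simps o_apply copy_letter_written append_assoc
      replicate_append_same replicate.simps append_Nil2 id_apply)

lemma copy_block_power:
  assumes "reads c i w"
  shows "((\<lambda>s. next_input ((copy_letter ^^ r) s)) ^^ length w) ((c, i), written v) =
    ((c, i + int (length w)), written (v @ concat (map (replicate r) w)))"
  using assms
proof (induction w arbitrary: i v)
  case (Cons a w)
  then have "next_input ((copy_letter ^^ r) ((c, i), written v)) =
      ((c, i + 1), written (v @ replicate r a))"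
    by (simp only: copy_letter_power) (simp add: next_input_def io_step_def act_eq fun_upd_idem)
  then show ?case using Cons.IH[of "i + 1" "v @ replicate r a"] Cons.prems
    by (simp add: funpow_Suc_right algebra_simps del: funpow.simps)
qed simp

subsection \<open>Joining\<close>

text \<open>The blank 0 is neutral, so that a join can be accumulated in a fresh output cell.\<close>

definition join_letter :: "nat \<Rightarrow> nat \<Rightarrow> nat" where
  "join_letter b a = (if b = 0 \<or> b = a then a else 3)"

definition join_step :: "tape \<times> tape \<Rightarrow> tape \<times> tape" where
  "join_step = io_step (\<lambda>a b. ((a, Move_Right), (join_letter b a, Stay)))"

definition next_output :: "tape \<times> tape \<Rightarrow> tape \<times> tape" where
  "next_output = io_step (\<lambda>a b. ((a, Stay), (b, Move_Right)))"

lemma join_step_power: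
  assumes "reads c i w"
  shows "(join_step ^^ length w) ((c, i), (word_tape (v @ [b]), int (length v))) =
    ((c, i + int (length w)), (word_tape (v @ [foldl join_letter b w]), int (length v)))"
  using assms
proof (induction w arbitrary: i b)
  case (Cons a w)
  then have "join_step ((c, i), (word_tape (v @ [b]), int (length v))) =
      ((c, i + 1), (word_tape (v @ [join_letter b a]), int (length v)))"
    by (simp add: join_step_def io_step_def act_eq fun_upd_idem flip: word_tape_snoc)
  with Cons show ?case by (simp add: funpow_Suc_right algebra_simps del: funpow.simps)
qed simp

lemma join_block:
  assumes "reads c i w"
  shows "next_output ((join_step ^^ length w) ((c, i), written v)) =
    ((c, i + int (length w)), written (v @ [foldl join_letter 0 w]))"
proof -
  \<comment> \<open>A trailing blank does not change the tape, so the fresh cell already holds an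
    accumulator with neutral value 0.\<close>
  have "word_tape v = word_tape (v @ [0])"
    by (auto simp: word_tape_def fun_eq_iff nth_append)
  then show ?thesis using join_step_power[OF assms, of v 0]
    by (simp add: next_output_def io_step_def act_eq)
qed

lemma join_block_power:
  assumes "reads c i (concat ws)" and "\<And>w. w \<in> set ws \<Longrightarrow> length w = m"
  shows "((\<lambda>s. next_output ((join_step ^^ m) s)) ^^ length ws) ((c, i), written v) =
    ((c, i + int (length (concat ws))), written (v @ map (foldl join_letter 0) ws))"
  using assms
proof (induction ws arbitrary: i v)
  case (Cons w ws)
  have "next_output ((join_step ^^ m) ((c, i), written v)) =
      ((c, i + int m), written (v @ [foldl join_letter 0 w]))"
    using Cons.prems join_block[of c i w v] by (simp add: reads_append)
  then show ?case
    using Cons.IH[of "i + int m" "v @ [foldl join_letter 0 w]"] Cons.prems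
    by (simp add: funpow_Suc_right reads_append algebra_simps del: funpow.simps)
qed simp

text \<open>The least upper bound of a nonempty set. The empty set has none, as \<open>Zero\<close>
  and \<open>One\<close> are distinct minimal elements; \<open>Star\<close> is a default value
  there.\<close>

definition join_values :: "pstar set \<Rightarrow> pstar" where
  "join_values S = (if S = {Zero} then Zero else if S = {One} then One else Star)"

lemma join_values_le_iff: "S \<noteq> {} \<Longrightarrow> join_values S \<le> y \<longleftrightarrow> (\<forall>x \<in> S. x \<le> y)"
  by (cases y) (auto simp: join_values_def less_eq_pstar_def; metis pstar.exhaust)+

text \<open>An empty list would leave the accumulator 0, which encodes no value. Induction from the
  right matches the order in which \<open>foldl\<close> consumes letters.\<close>

lemma foldl_join_letter:
  "vs \<noteq> [] \<Longrightarrow> foldl join_letter 0 (map value_letter vs) = value_letter (join_values (set vs))"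
proof (induction vs rule: rev_nonempty_induct)
  case (single x)
  show ?case by (cases x) (simp_all add: join_letter_def join_values_def)
next
  case (snoc x xs)
  have "join_values (insert x (set xs)) =
      (if join_values (set xs) = x then x else Star)"
    using snoc.hyps by (cases x) (auto simp: join_values_def subset_singleton_iff)
  then show ?case using snoc.IH
    by (cases x; cases "join_values (set xs)") (simp_all add: join_letter_def)
qed

section \<open>Tables in lexicographic order\<close>

abbreviation all_tuples :: "nat \<Rightarrow> nat \<Rightarrow> nat list list" where
  "all_tuples k n \<equiv> product_lists (replicate k [0..<n])"

lemma set_all_tuples: "set (all_tuples k n) = tuples k {..<n}"
proof -
  have "xs \<in> set (all_tuples k n) \<longleftrightarrow> xs \<in> tuples k {..<n}" for xs
    by (induction k arbitrary: xs) (auto simp: tuples_def length_Suc_conv image_iff)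
  then show ?thesis by blast
qed

lemma length_all_tuples: "length (all_tuples k n) = n ^ k"
  by (induction k) (simp_all add: length_concat comp_def sum_list_triv)

lemma concat_concat: "concat (concat xss) = concat (map concat xss)"
  by (induction xss) simp_all

text \<open>In lexicographic order the tuples with a common prefix \<open>s\<close> are consecutive.
  With prefixes of length 2 this gives the blocks on which both machines work.\<close>

lemma all_tuples_add:
  "all_tuples (k + l) n = concat (map (\<lambda>s. map (\<lambda>t. s @ t) (all_tuples l n)) (all_tuples k n))"
proof -
  have "map ((@) []) ts = ts" "map ((@) (x # s)) ts = map (\<lambda>t. x # s @ t) ts"
    for x :: nat and s ts
    by (induction ts) simp_all
  note map_append = this
  show ?thesis by (induction k) (simp_all add: map_concat comp_def concat_concat map_append)
qed

lemma encode_structure_Cons: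
  assumes "univ G = {..<n}"
  shows "encode_structure (k # ks) G = replicate n 4 @
    map (\<lambda>t. value_letter (rel G 0 t)) (all_tuples k n) @
    concat (map (\<lambda>i. map (\<lambda>t. value_letter (rel G (Suc i) t)) (all_tuples (ks ! i) n)) [0..<length ks])"
  using assms
  by (simp add: encode_structure_def Let_def upt_conv_Cons map_Suc_upt[symmetric] comp_def
      del: upt_Suc)

lemma value_letter_range: "value_letter x \<in> {1..3}"
  by (cases x) simp_all

section \<open>The two reductions\<close>

text \<open>The structure \<open>A\<close> is \<open>H\<close> with \<open>R\<^sub>1(x\<^sub>1,\<dots>,x\<^sub>k) = E(x\<^sub>1,x\<^sub>2)\<close> and all other relations constantly
  \<open>\<star>\<close>. A graph becomes a \<open>\<sigma>\<close>-structure in the same way, with \<open>0\<close> instead of \<open>\<star>\<close>;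
  conversely \<open>E(x\<^sub>1,x\<^sub>2)\<close> is the join of all \<open>R\<^sub>1(x\<^sub>1,x\<^sub>2,\<dots>)\<close>.\<close>

definition pad :: "pstar \<Rightarrow> (pstar, 'a) pstructure \<Rightarrow> (pstar, 'a) pstructure" where
  "pad p G = \<lparr>univ = univ G, rel = \<lambda>i t. if i = 0 then rel G 0 (take 2 t) else p\<rparr>"

definition collapse :: "nat \<Rightarrow> (pstar, 'a) pstructure \<Rightarrow> (pstar, 'a) pstructure" where
  "collapse r G = \<lparr>univ = univ G, rel = \<lambda>i s. join_values ((\<lambda>t. rel G 0 (s @ t)) ` tuples r (univ G))\<rparr>"

text \<open>The target must live on \<open>nat\<close>, while \<open>H\<close> has elements of any
  type; an isomorphic copy along an injection bridges this.\<close>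

definition rename :: "('a \<Rightarrow> 'b) \<Rightarrow> (pstar, 'a) pstructure \<Rightarrow> (pstar, 'b) pstructure" where
  "rename e G = \<lparr>univ = e ` univ G, rel = \<lambda>i t. rel G i (map (inv_into (univ G) e) t)\<rparr>"

section \<open>Effect of the constructions on homomorphisms\<close>

lemma ex_hom_rename:
  assumes "inj_on e (univ H)"
  shows "(\<exists>h. is_hom \<sigma> G (rename e H) h) \<longleftrightarrow> (\<exists>h. is_hom \<sigma> G H h)"
proof
  assume "\<exists>h. is_hom \<sigma> G (rename e H) h"
  then obtain h where h: "is_hom \<sigma> G (rename e H) h" by blast
  then have "h \<in> univ G \<rightarrow> e ` univ H" by (simp add: is_hom_def rename_def)
  then have "inv_into (univ H) e \<circ> h \<in> univ G \<rightarrow> univ H"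
    by (auto simp: Pi_iff intro: inv_into_into)
  with h have "is_hom \<sigma> G H (inv_into (univ H) e \<circ> h)"
    by (simp add: is_hom_def rename_def)
  then show "\<exists>h. is_hom \<sigma> G H h" by blast
next
  assume "\<exists>h. is_hom \<sigma> G H h"
  then obtain h where h: "is_hom \<sigma> G H h" by blast
  then have into: "h \<in> univ G \<rightarrow> univ H" by (simp add: is_hom_def)
  have eq: "map (inv_into (univ H) e) (map (e \<circ> h) t) = map h t"
    if "t \<in> tuples k (univ G)" for t k
    using that into assms by (auto simp: tuples_def inv_into_f_f Pi_iff)
  have "rel G i t \<le> rel (rename e H) i (map (e \<circ> h) t)"
    if "i < length \<sigma>" "t \<in> tuples (\<sigma> ! i) (univ G)" for i t
    using h that by (simp add: is_hom_def rename_def eq[OF that(2)] del: map_map)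
  with into have "is_hom \<sigma> G (rename e H) (e \<circ> h)"
    by (auto simp: is_hom_def rename_def)
  then show "\<exists>h. is_hom \<sigma> G (rename e H) h" by blast
qed

lemma is_hom_pad:
  assumes "is_hom graph_sig G H h" and "k \<ge> 2"
  shows "is_hom (k # ks) (pad Zero G) (pad Star H) h"
proof -
  have "take 2 t \<in> tuples 2 (univ G)" if "t \<in> tuples k (univ G)" for t
    using that assms(2) by (auto simp: tuples_def dest: in_set_takeD)
  with assms(1) show ?thesis
    by (auto simp: is_hom_def pad_def nth_Cons take_map less_eq_pstar_def split: nat.splits)
qed

lemma is_hom_if_pad:
  assumes "is_hom (k # ks) (pad p G) (pad q H) h" and "k \<ge> 2"
  shows "is_hom graph_sig G H h"
proof -
  have "rel G 0 s \<le> rel H 0 (map h s)" if s: "s \<in> tuples 2 (univ G)" for s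
  proof -
    \<comment> \<open>Any completion of the pair inside the domain would do; repeating its first
      entry needs no further element.\<close>
    let ?t = "s @ replicate (k - 2) (hd s)"
    have "?t \<in> tuples k (univ G)"
      using s assms(2) by (cases s) (auto simp: tuples_def)
    then have "rel (pad p G) 0 ?t \<le> rel (pad q H) 0 (map h ?t)"
      using assms(1)[unfolded is_hom_def, THEN conjunct2, rule_format, of 0 ?t]
      by (simp add: pad_def)
    then show ?thesis using s by (simp add: pad_def tuples_def)
  qed
  with assms(1) show ?thesis by (simp add: is_hom_def pad_def)
qed

text \<open>A join lies below \<open>E(h s)\<close> iff all joined values do, and
  \<open>Star\<close> is the top element, so the other relations impose nothing. The same maps
  \<open>h\<close> are homomorphisms on both sides.\<close>

lemma is_hom_collapse:
  fixes G :: "(pstar, 'a) pstructure" and H :: "(pstar, 'b) pstructure"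
  shows "is_hom graph_sig (collapse r G) H = is_hom (Suc (Suc r) # ks) G (pad Star H)"
  (is "?l = ?r")
proof
  fix h :: "'a \<Rightarrow> 'b"
  have "join_values ((\<lambda>t. rel G 0 (s @ t)) ` tuples r (univ G)) \<le> y \<longleftrightarrow>
      (\<forall>t \<in> tuples r (univ G). rel G 0 (s @ t) \<le> y)" if "s \<in> tuples 2 (univ G)" for s y
  proof -
    \<comment> \<open>The domain contains \<open>hd s\<close>, so the joined set is nonempty and its
      join is a genuine least upper bound.\<close>
    have "replicate r (hd s) \<in> tuples r (univ G)"
      using that by (cases s) (auto simp: tuples_def)
    then show ?thesis by (subst join_values_le_iff) auto
  qed
  moreover have "(\<forall>u \<in> tuples (Suc (Suc r)) (univ G). P u) \<longleftrightarrow>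
      (\<forall>s \<in> tuples 2 (univ G). \<forall>t \<in> tuples r (univ G). P (s @ t))" for P
  proof safe
    fix u assume P: "\<forall>s \<in> tuples 2 (univ G). \<forall>t \<in> tuples r (univ G). P (s @ t)"
      and "u \<in> tuples (Suc (Suc r)) (univ G)"
    then have "take 2 u \<in> tuples 2 (univ G)" "drop 2 u \<in> tuples r (univ G)"
      by (auto simp: tuples_def dest: in_set_takeD in_set_dropD)
    with P have "P (take 2 u @ drop 2 u)" by blast
    then show "P u" by simp
  qed (auto simp: tuples_def)
  moreover have "take 2 (map h (s @ t)) = map h s" if "s \<in> tuples 2 (univ G)" for s t
    using that by (simp add: tuples_def)
  ultimately show "?l h = ?r h"
    by (auto simp: is_hom_def collapse_def pad_def nth_Cons less_eq_pstar_def[of _ Star]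
        split: nat.splits)
qed

section \<open>Polynomial-time machines for both reductions\<close>

lemma poly_time_pad:
  assumes "k \<ge> 2"
  shows "poly_time_computable (instances (MP graph_sig H)) (encode_structure graph_sig)
    (encode_structure (k # ks)) (pad Zero)"
proof -
  define r where "r = k - 2"
  then have k: "k = 2 + r" using assms by simp
  \<comment> \<open>This bounds every arity in the signature, so there are enough counters for each
    table.\<close>
  define K where "K = k + sum_list ks"
  let ?f = "\<lambda>n s. (write_one ^^ (\<Sum>k\<leftarrow>ks. n ^ k))
      (((\<lambda>s. next_input ((copy_letter ^^ (n ^ r)) s)) ^^ (n ^ 2)) s)"
  have copy: "realizable K r (\<lambda>n. copy_letter ^^ (n ^ r))"
    unfolding copy_letter_def
    by (rule realizable_power[OF realizable_io_step]) (auto simp: K_def k)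
  have "realizable K r (\<lambda>n. next_input)"
    unfolding next_input_def by (rule realizable_io_step) simp
  from realizable_square[OF realizable_seq[OF copy this]]
  have "realizable K (Suc (Suc r)) (\<lambda>n. (\<lambda>s. next_input ((copy_letter ^^ (n ^ r)) s)) ^^ (n ^ 2))"
    by (simp add: K_def k)
  then have "realizable K K (\<lambda>n. (\<lambda>s. next_input ((copy_letter ^^ (n ^ r)) s)) ^^ (n ^ 2))"
    by (rule realizable_mono) (simp add: K_def k)
  moreover have "realizable K K (\<lambda>n. write_one ^^ (\<Sum>k\<leftarrow>ks. n ^ k))"
    unfolding write_one_def
    by (rule realizable_sum_powers[OF realizable_io_step])
      (auto simp: K_def intro: trans_le_add2 member_le_sum_list)
  ultimately have "realizable K K ?f" by (rule realizable_seq)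
  then show ?thesis
  proof (rule poly_time_computable_if_realizable)
    fix G assume "G \<in> instances (MP graph_sig H)"
    then obtain n where n: "univ G = {..<n}" by (auto simp: MP_def)
    let ?L = "map (\<lambda>t. value_letter (rel G 0 t)) (all_tuples 2 n)"
    have enc: "encode_structure graph_sig G = replicate n 4 @ ?L"
      using encode_structure_Cons[OF n, of 2 "[]"] by simp
    \<comment> \<open>The remaining tables are constant and adjacent, so only their total length
      matters.\<close>
    have ones: "concat (map (\<lambda>i. replicate (n ^ (ks ! i)) (Suc 0)) [0..<length ks]) =
        replicate (\<Sum>k\<leftarrow>ks. n ^ k) (Suc 0)" for ks
      by (induction ks) (simp_all add: upt_conv_Cons map_Suc_upt[symmetric] comp_def replicate_add
          del: upt_Suc)
    have "take 2 (s @ t) = s" if "s \<in> set (all_tuples 2 n)" for s t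
      using that by (simp add: set_all_tuples tuples_def)
    then have "map (\<lambda>t. value_letter (rel (pad Zero G) 0 t)) (all_tuples k n) =
        concat (map (replicate (n ^ r)) ?L)"
      unfolding k all_tuples_add
      by (auto simp: map_concat comp_def pad_def map_replicate_const length_all_tuples
          intro!: arg_cong[of _ _ concat])
    moreover have "univ (pad Zero G) = {..<n}" by (simp add: pad_def n)
    from encode_structure_Cons[OF this]
    have "encode_structure (k # ks) (pad Zero G) = replicate n 4 @
        map (\<lambda>t. value_letter (rel (pad Zero G) 0 t)) (all_tuples k n) @
        replicate (\<Sum>k\<leftarrow>ks. n ^ k) 1"
      by (simp add: pad_def map_replicate_const length_all_tuples ones)
    moreover have "reads (word_tape (encode_structure graph_sig G)) (int n) ?L"
      using reads_word_tape[of "replicate n 4" ?L "[]"] by (simp add: enc)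
    from copy_block_power[OF this, of "n ^ r" "replicate n 4"]
    have "?f n ((word_tape (encode_structure graph_sig G), int n), written (replicate n 4)) =
      ((word_tape (encode_structure graph_sig G), int n + int (n ^ 2)),
        written (replicate n 4 @ concat (map (replicate (n ^ r)) ?L) @
          replicate (\<Sum>k\<leftarrow>ks. n ^ k) 1))"
      by (simp add: length_all_tuples write_one_power del: length_append)
    moreover have "set ?L \<subseteq> {1..3}"
      unfolding set_map by (rule image_subsetI) (rule value_letter_range)
    ultimately show "\<exists>n L. encode_structure graph_sig G = replicate n 4 @ L \<and> set L \<subseteq> {1..3} \<and>
      fst (snd (?f n ((word_tape (encode_structure graph_sig G), int n), written (replicate n 4)))) =
        word_tape (encode_structure (k # ks) (pad Zero G))"
      using enc by (intro exI[of _ n] exI[of _ ?L]) simp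
  qed
qed

lemma poly_time_collapse:
  "poly_time_computable (instances (MP (Suc (Suc r) # ks) A)) (encode_structure (Suc (Suc r) # ks))
    (encode_structure graph_sig) (collapse r)"
proof -
  \<comment> \<open>Only the first table is read, so its arity many counters suffice:
    \<open>r\<close> within a block and 2 for the pairs.\<close>
  define K where "K = Suc (Suc r)"
  let ?f = "\<lambda>n. (\<lambda>s. next_output ((join_step ^^ (n ^ r)) s)) ^^ (n ^ 2)"
  have join: "realizable K r (\<lambda>n. join_step ^^ (n ^ r))"
    unfolding join_step_def
    by (rule realizable_power[OF realizable_io_step]) (auto simp: K_def join_letter_def)
  have "realizable K r (\<lambda>n. next_output)"
    unfolding next_output_def by (rule realizable_io_step) simp
  from realizable_square[OF realizable_seq[OF join this]]
  have "realizable K K ?f" by (simp add: K_def)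
  then show ?thesis
  proof (rule poly_time_computable_if_realizable)
    fix G assume "G \<in> instances (MP (Suc (Suc r) # ks) A)"
    then obtain n where n: "univ G = {..<n}" by (auto simp: MP_def)
    let ?enc = "encode_structure (Suc (Suc r) # ks) G"
    let ?block = "\<lambda>s. map (\<lambda>t. value_letter (rel G 0 (s @ t))) (all_tuples r n)"
    let ?ws = "map ?block (all_tuples 2 n)"
    let ?rest = "concat (map (\<lambda>i. map (\<lambda>t. value_letter (rel G (Suc i) t)) (all_tuples (ks ! i) n))
      [0..<length ks])"
    have "map (\<lambda>t. value_letter (rel G 0 t)) (all_tuples (2 + r) n) = concat ?ws"
      unfolding all_tuples_add by (simp add: map_concat comp_def)
    then have enc: "?enc = replicate n 4 @ concat ?ws @ ?rest"
      using encode_structure_Cons[OF n, of "Suc (Suc r)" ks] by simp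
    have "foldl join_letter 0 (?block s) = value_letter (rel (collapse r G) 0 s)"
      if "s \<in> set (all_tuples 2 n)" for s
    proof -
      have "s \<in> tuples 2 {..<n}" using that by (simp only: set_all_tuples)
      \<comment> \<open>The existence of a pair rules out the empty domain, so no block is empty and
        \<open>foldl_join_letter\<close> applies.\<close>
      then have "n \<noteq> 0" by (cases s) (auto simp: tuples_def)
      then have "all_tuples r n \<noteq> []"
        using length_all_tuples[of r n] by auto
      then show ?thesis
        using foldl_join_letter[of "map (\<lambda>t. rel G 0 (s @ t)) (all_tuples r n)"]
        by (simp add: comp_def collapse_def n set_all_tuples)
    qed
    then have "map (foldl join_letter 0) ?ws =
        map (\<lambda>s. value_letter (rel (collapse r G) 0 s)) (all_tuples 2 n)"
      by simp
    moreover have "univ (collapse r G) = {..<n}" by (simp add: collapse_def n)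
    from encode_structure_Cons[OF this, of 2 "[]"]
    have "encode_structure graph_sig (collapse r G) = replicate n 4 @
        map (\<lambda>s. value_letter (rel (collapse r G) 0 s)) (all_tuples 2 n)" by simp
    moreover have "reads (word_tape ?enc) (int n) (concat ?ws)"
      using reads_word_tape[of "replicate n 4" "concat ?ws" ?rest] by (simp only: enc length_replicate)
    then have "((\<lambda>s. next_output ((join_step ^^ (n ^ r)) s)) ^^ length ?ws)
        ((word_tape ?enc, int n), written (replicate n 4)) =
      ((word_tape ?enc, int n + int (length (concat ?ws))),
        written (replicate n 4 @ map (foldl join_letter 0) ?ws))"
      by (rule join_block_power) (auto simp: length_all_tuples)
    moreover have "length ?ws = n ^ 2" by (simp add: length_all_tuples)
    ultimately have "fst (snd (?f n ((word_tape ?enc, int n), written (replicate n 4)))) =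
        word_tape (encode_structure graph_sig (collapse r G))"
      by (simp add: comp_def cong: map_cong)
    moreover have "set (concat ?ws @ ?rest) \<subseteq> {1..3}"
      using value_letter_range by fastforce
    ultimately show "\<exists>n L. ?enc = replicate n 4 @ L \<and> set L \<subseteq> {1..3} \<and>
      fst (snd (?f n ((word_tape ?enc, int n), written (replicate n 4)))) =
        word_tape (encode_structure graph_sig (collapse r G))"
      using enc by blast
  qed
qed

theorem mainTheorem4:
  fixes \<sigma> :: signature and H :: "(pstar, 'a) pstructure"
  assumes "\<sigma> \<noteq> []" and "\<sigma> ! 0 \<ge> 2"
    and "finite_structure H" and "no_star_loop graph_sig H"
  shows "\<exists>A :: (pstar, nat) pstructure. finite_structure A \<and> no_star_loop \<sigma> A \<and>
    poly_equivalent (MP graph_sig H) (MP \<sigma> A)"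
proof -
  obtain k ks where \<sigma>: "\<sigma> = k # ks" and "k \<ge> 2"
    using assms(1,2) by (cases \<sigma>) auto
  then obtain r where r: "k = Suc (Suc r)"
    by (metis add_2_eq_Suc le_Suc_ex)
  obtain e :: "'a \<Rightarrow> nat" where e: "inj_on e (univ H)"
    using assms(3) finite_imp_inj_to_nat_seg unfolding finite_structure_def by blast
  let ?A = "rename e (pad Star H)"
  have yes: "yes (MP \<sigma> ?A) G \<longleftrightarrow> (\<exists>h. is_hom \<sigma> G (pad Star H) h)" for G
    using ex_hom_rename[of e "pad Star H" \<sigma> G] e by (simp add: MP_def pad_def)
  have "finite_structure ?A"
    using assms(3) by (simp add: finite_structure_def rename_def pad_def)
  moreover have "no_star_loop \<sigma> ?A"
    unfolding no_star_loop_def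
  proof
    \<comment> \<open>The padded relations of \<open>?A\<close> are \<open>Star\<close> everywhere,
      so the condition must come from relation 0, whose loops are those of \<open>H\<close>.\<close>
    assume "\<exists>x \<in> univ ?A. \<forall>i < length \<sigma>. rel ?A i (replicate (\<sigma> ! i) x) = Star"
    then obtain x where "x \<in> univ H" "rel ?A 0 (replicate k (e x)) = Star"
      by (auto simp: \<sigma> rename_def pad_def)
    with e have "rel H 0 (replicate 2 x) = Star"
      by (simp add: rename_def pad_def r inv_into_f_f numeral_2_eq_2)
    with \<open>x \<in> univ H\<close> assms(4) show False by (auto simp: no_star_loop_def)
  qed
  moreover have "poly_reduces (MP graph_sig H) (MP \<sigma> ?A)"
    unfolding poly_reduces_def
  proof (intro bexI conjI ballI)
    show "poly_time_computable (instances (MP graph_sig H)) (encode (MP graph_sig H))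
        (encode (MP \<sigma> ?A)) (pad Zero)"
      using poly_time_pad[OF \<open>k \<ge> 2\<close>, of H ks] by (simp add: MP_def \<sigma>)
    show "yes (MP graph_sig H) G \<longleftrightarrow> yes (MP \<sigma> ?A) (pad Zero G)" for G
      unfolding yes using is_hom_pad[OF _ \<open>k \<ge> 2\<close>] is_hom_if_pad[OF _ \<open>k \<ge> 2\<close>]
      by (fastforce simp: MP_def \<sigma>)
    show "pad Zero \<in> instances (MP graph_sig H) \<rightarrow> instances (MP \<sigma> ?A)"
      by (auto simp: MP_def pad_def)
  qed
  moreover have "poly_reduces (MP \<sigma> ?A) (MP graph_sig H)"
    unfolding poly_reduces_def
  proof (intro bexI conjI ballI)
    show "poly_time_computable (instances (MP \<sigma> ?A)) (encode (MP \<sigma> ?A))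
        (encode (MP graph_sig H)) (collapse r)"
      using poly_time_collapse[of r ks ?A] by (simp add: MP_def \<sigma> r)
    show "yes (MP \<sigma> ?A) G \<longleftrightarrow> yes (MP graph_sig H) (collapse r G)" for G
      unfolding yes unfolding \<sigma> r
      by (simp only: MP_def problem.simps is_hom_collapse[of r G H ks])
    show "collapse r \<in> instances (MP \<sigma> ?A) \<rightarrow> instances (MP graph_sig H)"
      by (auto simp: MP_def collapse_def)
  qed
  ultimately show ?thesis unfolding poly_equivalent_def by blast
qed

end
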